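(* Let $p,m\ge 1$, $J:=\{1,\ldots,p\}$, $I:=\{1,\ldots,m\}$. For each $k=0,1,2,\ldots$, let $U_k:=U_p^kU_{p-1}^k\cdots U_1^k$ (composition), where $U_j^k\colon\mathcal H\to\mathcal H$ is $\rho_j^k$-strongly quasi-nonexpansive for $j\in J$, and $\rho:=\min_{j\in J}\inf_k\rho_j^k>0$. (Upper indices $k$ are indices, not powers.) For each $i\in I$ let $C_i\subseteq\mathcal H$ be closed and convex. Let $F_0:=\bigcap_{j\in J}\bigcap_{k\ge 0}\operatorname{Fix}U_j^k$ and $C:=\bigcap_{i\in I}C_i$, and assume that $C\subseteq F_0$ and $C\ne\emptyset$. Let $S:=B(z,R)$ for some $z\in C$ and $R>0$. (i) Suppose that for some $i\in I$ there is a sequence $\{j_k\}_{k=0}^\infty\subseteq J$ such that the sequence $\{U_{j_k}^k\}_{k=0}^\infty$ is weakly $C_i$-regular over $S$. Then $\{U_k\}_{k=0}^\infty$ is weakly $C_i$-regular over $S$. If this property holds for all $i\in I$ (with $\{j_k\}$ allowed to depend on $i$), then $\{U_k\}_{k=0}^\infty$ is weakly $C$-regular over $S$. (ii) Suppose that for some $i\in I$ there is a sequence $\{j_k\}_{k=0}^\infty\subseteq J$ such that the sequence $\{U_{j_k}^k\}_{k=0}^\infty$ is $C_i$-regular over $S$. Then $\{U_k\}_{k=0}^\infty$ is $C_i$-regular over $S$. If this property holds for all $i\in I$ (with $\{j_k\}$ allowed to depend on $i$) and $\{C_i\mid i\in I\}$ is regular over $S$, then $\{U_k\}_{k=0}^\infty$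 is $C$-regular over $S$. (iii) Suppose that for every $i\in I$ there is a sequence $\{j_k\}_{k=0}^\infty\subseteq J$ (depending on $i$) such that the sequence $\{U_{j_k}^k\}_{k=0}^\infty$ is linearly $C_i$-regular over $S$ with modulus $\delta_i\ge 1$; let $\delta:=\min_{i\in I}\delta_i$, and suppose that $\{C_i\mid i\in I\}$ is linearly regular over $S$ with modulus $\kappa>0$. Then $\{U_k\}_{k=0}^\infty$ is linearly $C$-regular over $S$ with modulus $2p\kappa^2\delta^2/\rho$.
   Context: $\mathcal H$ is a real Hilbert space, $\operatorname{Fix}U:=\{x\in\mathcal H\mid Ux=x\}$, $d(x,C):=\inf_{y\in C}\|x-y\|$, and $B(z,R):=\{x\in\mathcal H\mid\|x-z\|\le R\}$. For $\rho\ge 0$, an operator $T\colon\mathcal H\to\mathcal H$ is $\rho$-strongly quasi-nonexpansive if $\operatorname{Fix}T\ne\emptyset$ and $\|Tu-z\|^2\le\|u-z\|^2-\rho\|Tu-u\|^2$ for all $u\in\mathcal H$, $z\in\operatorname{Fix}T$; it is quasi-nonexpansive if this holds with $\rho=0$. Regular sequences of operators. Let $S\subseteq\mathcal H$ be nonempty and $D\subseteq\mathcal H$ be nonempty, closed and convex. A sequence $\{V_k\}_{k=0}^\infty$ of quasi-nonexpansive operators $V_k\colon\mathcal H\to\mathcal H$ is: (a) weakly $D$-regular over $S$ if for every sequence $\{x^k\}_{k=0}^\infty\subseteq S$ and every strictly increasing sequence $\{n_k\}$ of nonnegative integers, $x^{n_k}\rightharpoonup y$ (weakly, as $k\to\infty$)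 and $\|V_kx^k-x^k\|\to 0$ imply $y\in D$; (b) $D$-regular over $S$ if for every sequence $\{x^k\}_{k=0}^\infty\subseteq S$, $\|V_kx^k-x^k\|\to 0$ implies $d(x^k,D)\to 0$; (c) linearly $D$-regular over $S$ with modulus $\delta>0$ if $d(x,D)\le\delta\|V_kx-x\|$ for all $x\in S$ and all $k=0,1,2,\ldots$. Regular families of sets. A family of closed convex sets $C_i$, $i\in I=\{1,\ldots,m\}$, with $C=\bigcap_{i\in I}C_i\neq\emptyset$ is regular over $S$ if for every sequence $\{x^k\}_{k=0}^\infty\subseteq S$, $\max_{i\in I}d(x^k,C_i)\to 0$ implies $d(x^k,C)\to 0$; it is linearly regular over $S$ with modulus $\kappa>0$ if $d(x,C)\le\kappa\max_{i\in I}d(x,C_i)$ for all $x\in S$.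
   Formalization: In (iii), δ is taken as max of the δ_i instead of min; with min the claim fails, e.g. H=ℝ, p=1, U x=0.99x (ρ=199), C_1=ℝ, C_2={0}, δ_1=1, δ_2=100, κ=1. *)

theory Defs
  imports "HOL-Analysis.Analysis"
begin

text \<open>
  A real Hilbert space is a type of sort \<open>{real_inner, complete_space}\<close>, and \<open>d(x, C)\<close> is
  \<^const>\<open>infdist\<close>. That constant is \<open>0\<close> on the empty set; every set it is applied to below is
  required to be nonempty.
\<close>

definition Fix :: "('a \<Rightarrow> 'a) \<Rightarrow> 'a set" where
  "Fix T = {x. T x = x}"

definition strongly_quasi_nonexpansive :: "real \<Rightarrow> ('a::real_inner \<Rightarrow> 'a) \<Rightarrow> bool" where
  "strongly_quasi_nonexpansive \<rho> T \<longleftrightarrow>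
     \<rho> \<ge> 0 \<and> Fix T \<noteq> {} \<and>
     (\<forall>u. \<forall>z\<in>Fix T. (norm (T u - z))\<^sup>2 \<le> (norm (u - z))\<^sup>2 - \<rho> * (norm (T u - u))\<^sup>2)"

definition quasi_nonexpansive :: "('a::real_inner \<Rightarrow> 'a) \<Rightarrow> bool" where
  "quasi_nonexpansive T \<longleftrightarrow> strongly_quasi_nonexpansive 0 T"

definition weakly_converges :: "(nat \<Rightarrow> 'a::real_normed_vector) \<Rightarrow> 'a \<Rightarrow> bool" where
  "weakly_converges x y \<longleftrightarrow>
     (\<forall>f :: 'a \<Rightarrow> real. bounded_linear f \<longrightarrow> (\<lambda>k. f (x k)) \<longlonglongrightarrow> f y)"

text \<open>
  The standing requirements under which the three notions of regularity of a sequence of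
  operators are defined; they are part of each notion.
\<close>

definition regularity_setting ::
    "'a::real_inner set \<Rightarrow> 'a set \<Rightarrow> (nat \<Rightarrow> 'a \<Rightarrow> 'a) \<Rightarrow> bool" where
  "regularity_setting D S V \<longleftrightarrow>
     S \<noteq> {} \<and> D \<noteq> {} \<and> closed D \<and> convex D \<and> (\<forall>k. quasi_nonexpansive (V k))"

definition weakly_regular ::
    "'a::real_inner set \<Rightarrow> 'a set \<Rightarrow> (nat \<Rightarrow> 'a \<Rightarrow> 'a) \<Rightarrow> bool" where
  "weakly_regular D S V \<longleftrightarrow>
     regularity_setting D S V \<and>
     (\<forall>x n y. (\<forall>k. x k \<in> S) \<longrightarrow> strict_mono n \<longrightarrow>
        weakly_converges (\<lambda>k. x (n k)) y \<longrightarrow>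
        (\<lambda>k. norm (V k (x k) - x k)) \<longlonglongrightarrow> 0 \<longrightarrow> y \<in> D)"

definition regular ::
    "'a::real_inner set \<Rightarrow> 'a set \<Rightarrow> (nat \<Rightarrow> 'a \<Rightarrow> 'a) \<Rightarrow> bool" where
  "regular D S V \<longleftrightarrow>
     regularity_setting D S V \<and>
     (\<forall>x. (\<forall>k. x k \<in> S) \<longrightarrow>
        (\<lambda>k. norm (V k (x k) - x k)) \<longlonglongrightarrow> 0 \<longrightarrow>
        (\<lambda>k. infdist (x k) D) \<longlonglongrightarrow> 0)"

text \<open>
  A modulus bounds a distance from above, so it may always be enlarged. A modulus that serves
  several sequences with moduli \<open>\<delta> i\<close> at once is their maximum, not their minimum.
\<close>

definition linearly_regular ::
    "'a::real_inner set \<Rightarrow> 'a set \<Rightarrow> real \<Rightarrow> (nat \<Rightarrow> 'a \<Rightarrow> 'a) \<Rightarrow> bool" where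
  "linearly_regular D S \<delta> V \<longleftrightarrow>
     regularity_setting D S V \<and> \<delta> > 0 \<and>
     (\<forall>x\<in>S. \<forall>k. infdist x D \<le> \<delta> * norm (V k x - x))"

definition family_setting :: "nat set \<Rightarrow> (nat \<Rightarrow> 'a::real_inner set) \<Rightarrow> 'a set \<Rightarrow> bool" where
  "family_setting I C S \<longleftrightarrow>
     finite I \<and> I \<noteq> {} \<and> S \<noteq> {} \<and> (\<forall>i\<in>I. closed (C i) \<and> convex (C i)) \<and> (\<Inter>i\<in>I. C i) \<noteq> {}"

definition regular_family :: "nat set \<Rightarrow> (nat \<Rightarrow> 'a::real_inner set) \<Rightarrow> 'a set \<Rightarrow> bool" where
  "regular_family I C S \<longleftrightarrow>
     family_setting I C S \<and>
     (\<forall>x. (\<forall>k::nat. x k \<in> S) \<longrightarrow>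
        (\<lambda>k. Max ((\<lambda>i. infdist (x k) (C i)) ` I)) \<longlonglongrightarrow> 0 \<longrightarrow>
        (\<lambda>k. infdist (x k) (\<Inter>i\<in>I. C i)) \<longlonglongrightarrow> 0)"

definition linearly_regular_family ::
    "nat set \<Rightarrow> (nat \<Rightarrow> 'a::real_inner set) \<Rightarrow> 'a set \<Rightarrow> real \<Rightarrow> bool" where
  "linearly_regular_family I C S \<kappa> \<longleftrightarrow>
     family_setting I C S \<and> \<kappa> > 0 \<and>
     (\<forall>x\<in>S. infdist x (\<Inter>i\<in>I. C i) \<le> \<kappa> * Max ((\<lambda>i. infdist x (C i)) ` I))"

text \<open>
  With \<open>U j k\<close> for \<open>U\<^sub>j\<^sup>k\<close>, this is \<open>U\<^sub>p\<^sup>k \<circ> \<dots> \<circ> U\<^sub>1\<^sup>k\<close>: \<open>U 1 k\<close> is applied first.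
\<close>

definition composed :: "nat \<Rightarrow> (nat \<Rightarrow> nat \<Rightarrow> 'a \<Rightarrow> 'a) \<Rightarrow> nat \<Rightarrow> 'a \<Rightarrow> 'a" where
  "composed p U k = fold (\<lambda>j. U j k) [1..<Suc p]"

end

theory Submission
  imports Defs
begin

text \<open>
  Follow a point \<open>x\<close> through one product \<open>U\<^sub>p\<^sup>k \<circ> \<dots> \<circ> U\<^sub>1\<^sup>k\<close>, along the
  points \<open>Q\<^sub>0 x = x, Q\<^sub>1 x, \<dots>, Q\<^sub>p x\<close>. Strong quasi-nonexpansiveness says that each step
  lowers the squared distance to a common fixed point \<open>c\<close> by at least \<open>\<rho>\<close> times the squared
  length of the step. Telescoping bounds the sum of the squared lengths by
  \<open>(\<parallel>x - c\<parallel>\<^sup>2 - \<parallel>Q\<^sub>p x - c\<parallel>\<^sup>2) / \<rho>\<close>. As \<open>Q\<^sub>p\<close> does not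
  increase the distance to \<open>c\<close>, that difference of squares is at most
  \<open>2 \<parallel>x - c\<parallel> \<parallel>Q\<^sub>p x - x\<parallel>\<close>, and Cauchy--Schwarz then bounds
  the length \<open>L\<close> of the whole path by
  \<open>L\<^sup>2 \<le> (2 p / \<rho>) \<parallel>x - c\<parallel> \<parallel>Q\<^sub>p x - x\<parallel>\<close>
  (\<open>path_length_bound\<close>). All three parts rest on this estimate.

  On a ball around a common fixed point it shows that the whole path shrinks to \<open>x\<close> as soon as
  the product moves \<open>x\<close> little. If \<open>y\<close> is the point of the path to which the single operator
  \<open>U\<^sub>j\<^sup>k\<close> is applied, then both \<open>\<parallel>y - x\<parallel>\<close> and
  \<open>\<parallel>U\<^sub>j\<^sup>k y - y\<parallel>\<close> are at most \<open>L\<close>, and \<open>y\<close> is still in the ball.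
  Hence the regularity of the single operators applies to the points \<open>y\<close>, and since
  \<open>y - x \<rightarrow> 0\<close> its conclusion carries over to the points \<open>x\<close>. The passage from the sets \<open>C\<^sub>i\<close>
  to their intersection is immediate for weak regularity, and is exactly what regularity of the
  family provides for regularity in norm.

  In the linear case, with \<open>\<delta>\<close> the largest of the moduli \<open>\<delta>\<^sub>i\<close>, the same two bounds
  give \<open>d(x, C\<^sub>i) \<le> \<delta> L\<close> for every \<open>i\<close>, hence
  \<open>d(x, C)\<^sup>2 \<le> \<kappa>\<^sup>2 \<delta>\<^sup>2 L\<^sup>2 \<le> (2 p \<kappa>\<^sup>2 \<delta>\<^sup>2 / \<rho>) \<parallel>x - c\<parallel> \<parallel>Q\<^sub>p x - x\<parallel>\<close>
  for every \<open>c \<in> C\<close>. The infimum over \<open>c\<close> turns \<open>\<parallel>x - c\<parallel>\<close> into \<open>d(x, C)\<close>, and one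
  factor \<open>d(x, C)\<close> cancels.
\<close>

section \<open>Paths of products of strongly quasi-nonexpansive operators\<close>

lemma strongly_quasi_nonexpansive_mono:
  assumes "strongly_quasi_nonexpansive r T" "0 \<le> s" "s \<le> r"
  shows "strongly_quasi_nonexpansive s T"
  unfolding strongly_quasi_nonexpansive_def
proof (intro conjI allI ballI)
  show "0 \<le> s" by fact
  show "Fix T \<noteq> {}"
    using assms(1) by (simp add: strongly_quasi_nonexpansive_def)
next
  fix u z assume "z \<in> Fix T"
  then have "(norm (T u - z))\<^sup>2 \<le> (norm (u - z))\<^sup>2 - r * (norm (T u - u))\<^sup>2"
    using assms(1) by (simp add: strongly_quasi_nonexpansive_def)
  moreover have "s * (norm (T u - u))\<^sup>2 \<le> r * (norm (T u - u))\<^sup>2"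
    using assms(3) by (simp add: mult_right_mono)
  ultimately show "(norm (T u - z))\<^sup>2 \<le> (norm (u - z))\<^sup>2 - s * (norm (T u - u))\<^sup>2"
    by linarith
qed

lemma composed_0 [simp]: "composed 0 U k x = x"
  by (simp add: composed_def)

lemma composed_Suc [simp]: "composed (Suc q) U k x = U (Suc q) k (composed q U k x)"
  by (simp add: composed_def)

definition path_length ::
    "nat \<Rightarrow> (nat \<Rightarrow> nat \<Rightarrow> 'a::real_normed_vector \<Rightarrow> 'a) \<Rightarrow> nat \<Rightarrow> 'a \<Rightarrow> real" where
  "path_length p U k x = (\<Sum>l<p. norm (composed (Suc l) U k x - composed l U k x))"

lemma norm_step_le_path_length:
  assumes "l < p"
  shows "norm (U (Suc l) k (composed l U k x) - composed l U k x) \<le> path_length p U k x"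
  unfolding path_length_def composed_Suc
  by (rule member_le_sum) (use assms in auto)

lemma norm_composed_diff_le_path_length:
  assumes "q \<le> p"
  shows "norm (composed q U k x - x) \<le> path_length p U k x"
proof -
  have "composed q U k x - x = (\<Sum>l<q. composed (Suc l) U k x - composed l U k x)"
    using sum_lessThan_telescope[of "\<lambda>l. composed l U k x" q] by simp
  then have "norm (composed q U k x - x)
      \<le> (\<Sum>l<q. norm (composed (Suc l) U k x - composed l U k x))"
    by (metis norm_sum)
  also have "\<dots> \<le> path_length p U k x"
    unfolding path_length_def by (rule sum_mono2) (use assms in auto)
  finally show ?thesis .
qed

lemma regularity_settingD:
  "weakly_regular D S V \<Longrightarrow> regularity_setting D S V"
  "regular D S V \<Longrightarrow> regularity_setting D S V"
  "linearly_regular D S \<delta> V \<Longrightarrow> regularity_setting D S V"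
  unfolding weakly_regular_def regular_def linearly_regular_def by (erule conjunct1)+

lemma weakly_regularD:
  assumes "weakly_regular D S V" "\<forall>k. x k \<in> S" "strict_mono n"
    "weakly_converges (\<lambda>k. x (n k)) y" "(\<lambda>k. norm (V k (x k) - x k)) \<longlonglongrightarrow> 0"
  shows "y \<in> D"
  using assms unfolding weakly_regular_def by blast

lemma regularD:
  assumes "regular D S V" "\<forall>k. x k \<in> S" "(\<lambda>k. norm (V k (x k) - x k)) \<longlonglongrightarrow> 0"
  shows "(\<lambda>k. infdist (x k) D) \<longlonglongrightarrow> 0"
  using assms unfolding regular_def by blast

lemma linearly_regularD:
  assumes "linearly_regular D S \<delta> V" "x \<in> S"
  shows "infdist x D \<le> \<delta> * norm (V k x - x)"
  using assms by (simp add: linearly_regular_def)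

text \<open>
  One constant \<open>r\<close> serves all factors: by monotonicity in the constant, operators with individual
  constants fit in through a common positive lower bound. The set \<open>F\<close> need not contain all common
  fixed points, so an intersection of target sets can take its place.
\<close>

locale strongly_quasi_nonexpansive_products =
  fixes p :: nat and U :: "nat \<Rightarrow> nat \<Rightarrow> 'a::real_inner \<Rightarrow> 'a" and r :: real and F :: "'a set"
  assumes r_pos: "r > 0"
    and sqne: "j \<in> {1..p} \<Longrightarrow> strongly_quasi_nonexpansive r (U j k)"
    and F_nonempty: "F \<noteq> {}"
    and F_fixed: "F \<subseteq> (\<Inter>j\<in>{1..p}. \<Inter>k. Fix (U j k))"
begin

lemma fixed_in: "c \<in> F \<Longrightarrow> j \<in> {1..p} \<Longrightarrow> c \<in> Fix (U j k)"
  using F_fixed by blast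

text \<open>
  The fixed point is allowed to depend on \<open>k\<close>: the fixed points of a product at a single \<open>k\<close> are
  compared with those of its factors at the same \<open>k\<close>.
\<close>

lemma composed_decrease:
  assumes "q \<le> p" and "\<And>j. j \<in> {1..p} \<Longrightarrow> c \<in> Fix (U j k)"
  shows "(norm (composed q U k x - c))\<^sup>2 \<le> (norm (x - c))\<^sup>2
     - r * (\<Sum>l<q. (norm (composed (Suc l) U k x - composed l U k x))\<^sup>2)"
  using assms(1)
proof (induction q)
  case 0
  then show ?case by simp
next
  case (Suc q)
  let ?y = "composed q U k x"
  have "Suc q \<in> {1..p}"
    using Suc.prems by simp
  then have "(norm (U (Suc q) k ?y - c))\<^sup>2
      \<le> (norm (?y - c))\<^sup>2 - r * (norm (U (Suc q) k ?y - ?y))\<^sup>2"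
    using sqne[of "Suc q" k] assms(2) by (simp add: strongly_quasi_nonexpansive_def)
  then show ?case
    using Suc by (simp add: distrib_left)
qed

lemma composed_contracts:
  assumes "q \<le> p" and "\<And>j. j \<in> {1..p} \<Longrightarrow> c \<in> Fix (U j k)"
  shows "norm (composed q U k x - c) \<le> norm (x - c)"
proof -
  have "0 \<le> r * (\<Sum>l<q. (norm (composed (Suc l) U k x - composed l U k x))\<^sup>2)"
    using r_pos by (intro mult_nonneg_nonneg sum_nonneg) auto
  then have "(norm (composed q U k x - c))\<^sup>2 \<le> (norm (x - c))\<^sup>2"
    using composed_decrease[OF assms, where x = x] by linarith
  then show ?thesis
    using norm_ge_zero power2_le_imp_le by blast
qed

text \<open>The estimate on which all three kinds of regularity rest.\<close>

lemma path_length_bound: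
  assumes "\<And>j. j \<in> {1..p} \<Longrightarrow> c \<in> Fix (U j k)"
  shows "(path_length p U k x)\<^sup>2
     \<le> 2 * real p / r * norm (x - c) * norm (composed p U k x - x)"
proof -
  let ?y = "composed p U k x"
  let ?E = "\<Sum>l<p. (norm (composed (Suc l) U k x - composed l U k x))\<^sup>2"
  have contr: "norm (?y - c) \<le> norm (x - c)"
    using composed_contracts assms by blast
  have tri: "norm (x - c) - norm (?y - c) \<le> norm (?y - x)"
    using norm_triangle_ineq2[of "x - c" "?y - c"] by (simp add: norm_minus_commute)
  have "r * ?E \<le> (norm (x - c))\<^sup>2 - (norm (?y - c))\<^sup>2"
    using composed_decrease[OF order_refl assms, where x = x] by linarith
  also have "\<dots> = (norm (x - c) + norm (?y - c)) * (norm (x - c) - norm (?y - c))"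
    by (simp add: power2_eq_square algebra_simps)
  also have "\<dots> \<le> (2 * norm (x - c)) * norm (?y - x)"
    using contr tri by (intro mult_mono) auto
  finally have E: "?E \<le> 2 * norm (x - c) * norm (?y - x) / r"
    using r_pos by (simp add: field_simps)
  have "(path_length p U k x)\<^sup>2 \<le> real p * ?E"
    using sum_squared_le_sum_of_squares[of
        "\<lambda>l. norm (composed (Suc l) U k x - composed l U k x)" "{..<p}"]
    by (simp add: path_length_def mult.commute)
  also have "\<dots> \<le> real p * (2 * norm (x - c) * norm (?y - x) / r)"
    using E by (intro mult_left_mono) auto
  finally show ?thesis
    by (simp add: mult_ac)
qed

text \<open>
  A fixed point of the product spans a path of length zero, so every factor fixes it.
\<close>

lemma Fix_composed:
  "Fix (composed p U k) = (\<Inter>j\<in>{1..p}. Fix (U j k))"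
proof (intro equalityI subsetI)
  fix x assume "x \<in> Fix (composed p U k)"
  then have fixed: "composed p U k x = x"
    by (simp add: Fix_def)
  obtain c where c: "c \<in> F"
    using F_nonempty by blast
  have "(path_length p U k x)\<^sup>2 \<le> 0"
    using path_length_bound[OF fixed_in[OF c], of k x] fixed by simp
  then have zero: "path_length p U k x = 0"
    by simp
  have "x \<in> Fix (U j k)" if j: "j \<in> {1..p}" for j
  proof -
    obtain l where l: "j = Suc l" "l < p"
      using j by (cases j) auto
    have "composed l U k x = x"
      using norm_composed_diff_le_path_length[of l p U k x] l zero by simp
    then show ?thesis
      using norm_step_le_path_length[OF l(2), of U k x] zero l by (simp add: Fix_def)
  qed
  then show "x \<in> (\<Inter>j\<in>{1..p}. Fix (U j k))"
    by blast
next
  fix x assume x: "x \<in> (\<Inter>j\<in>{1..p}. Fix (U j k))"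
  have "composed p U k x = x"
    using composed_contracts[of p x k x] x by auto
  then show "x \<in> Fix (composed p U k)"
    by (simp add: Fix_def)
qed

lemma quasi_nonexpansive_composed: "quasi_nonexpansive (composed p U k)"
  unfolding quasi_nonexpansive_def strongly_quasi_nonexpansive_def
proof (intro conjI allI ballI)
  show "Fix (composed p U k) \<noteq> {}"
    using F_nonempty fixed_in unfolding Fix_composed by blast
next
  fix u c assume "c \<in> Fix (composed p U k)"
  then have "norm (composed p U k u - c) \<le> norm (u - c)"
    by (intro composed_contracts) (auto simp: Fix_composed)
  then show "(norm (composed p U k u - c))\<^sup>2
      \<le> (norm (u - c))\<^sup>2 - 0 * (norm (composed p U k u - u))\<^sup>2"
    by (simp add: power_mono)
qed simp

lemma regularity_setting_composed:
  "regularity_setting D S V \<Longrightarrow> regularity_setting D S (composed p U)"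
  by (simp add: regularity_setting_def quasi_nonexpansive_composed)

text \<open>The point \<open>Q\<^bsub>j-1\<^esub> x\<close> is the one to which the \<open>j\<close>-th factor is applied, so this is what turns
  a bound on the path into information about a single factor.\<close>

lemma intermediate_point:
  assumes j: "j \<in> {1..p}"
  shows "norm (composed (j - 1) U k x - x) \<le> path_length p U k x"
    and "norm (U j k (composed (j - 1) U k x) - composed (j - 1) U k x) \<le> path_length p U k x"
    and "c \<in> F \<Longrightarrow> x \<in> cball c R \<Longrightarrow> composed (j - 1) U k x \<in> cball c R"
proof -
  show "norm (composed (j - 1) U k x - x) \<le> path_length p U k x"
    using j by (intro norm_composed_diff_le_path_length) auto
  show "norm (U j k (composed (j - 1) U k x) - composed (j - 1) U k x) \<le> path_length p U k x"
    using norm_step_le_path_length[of "j - 1" p U k x] j by auto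
  assume "c \<in> F" "x \<in> cball c R"
  moreover from this have "norm (composed (j - 1) U k x - c) \<le> norm (x - c)"
    using fixed_in j by (intro composed_contracts) auto
  ultimately show "composed (j - 1) U k x \<in> cball c R"
    by (simp add: dist_norm norm_minus_commute)
qed

lemma path_length_tendsto_zero:
  assumes c: "c \<in> F" and x: "\<forall>k. x k \<in> cball c R"
    and lim: "(\<lambda>k. norm (composed p U k (x k) - x k)) \<longlonglongrightarrow> 0"
  shows "(\<lambda>k. path_length p U k (x k)) \<longlonglongrightarrow> 0"
proof -
  let ?b = "\<lambda>k. 2 * real p / r * R * norm (composed p U k (x k) - x k)"
  have le: "norm ((path_length p U k (x k))\<^sup>2) \<le> ?b k" for k
  proof -
    have "norm (x k - c) \<le> R"
      using spec[OF x, of k] by (simp add: dist_norm norm_minus_commute)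
    then have "2 * real p / r * norm (x k - c) * norm (composed p U k (x k) - x k) \<le> ?b k"
      using r_pos by (intro mult_right_mono mult_left_mono) auto
    then show ?thesis
      using path_length_bound[OF fixed_in[OF c], of k "x k"] by simp
  qed
  have "?b \<longlonglongrightarrow> 0"
    using tendsto_mult_left[OF lim, of "2 * real p / r * R"] by simp
  then have "(\<lambda>k. (path_length p U k (x k))\<^sup>2) \<longlonglongrightarrow> 0"
    by (rule Lim_null_comparison[OF always_eventually[OF allI[OF le]]])
  then show ?thesis
    by simp
qed

section \<open>Regularity of a factor passes to the product\<close>

text \<open>
  The common core of the weak and the norm version: the points at which the chosen factors act
  stay in the ball, approach the given points, and are moved less and less by these factors.
\<close>

lemma intermediate_sequence:
  assumes c: "c \<in> F" and x: "\<forall>k. x k \<in> cball c R" and j: "\<forall>k. j k \<in> {1..p}"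
    and lim: "(\<lambda>k. norm (composed p U k (x k) - x k)) \<longlonglongrightarrow> 0"
  obtains y where "\<forall>k. y k \<in> cball c R" "(\<lambda>k. y k - x k) \<longlonglongrightarrow> 0"
    "(\<lambda>k. norm (U (j k) k (y k) - y k)) \<longlonglongrightarrow> 0"
proof
  let ?y = "\<lambda>k. composed (j k - 1) U k (x k)"
  note path = path_length_tendsto_zero[OF c x lim]
  show "\<forall>k. ?y k \<in> cball c R"
    by (intro allI intermediate_point(3) spec[OF j] spec[OF x] c)
  show "(\<lambda>k. ?y k - x k) \<longlonglongrightarrow> 0"
    by (rule Lim_null_comparison[OF always_eventually path]) (intro allI intermediate_point(1) spec[OF j])
  show "(\<lambda>k. norm (U (j k) k (?y k) - ?y k)) \<longlonglongrightarrow> 0"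
    by (rule Lim_null_comparison[OF always_eventually path])
      (simp only: real_norm_def abs_norm_cancel, intro allI intermediate_point(2) spec[OF j])
qed

lemma weakly_regular_composed:
  assumes c: "c \<in> F" and j: "\<forall>k. j k \<in> {1..p}"
    and reg: "weakly_regular D (cball c R) (\<lambda>k. U (j k) k)"
  shows "weakly_regular D (cball c R) (composed p U)"
  unfolding weakly_regular_def
proof (intro conjI allI impI)
  show "regularity_setting D (cball c R) (composed p U)"
    by (rule regularity_setting_composed[OF regularity_settingD(1)[OF reg]])
next
  fix x n w
  assume x: "\<forall>k. x k \<in> cball c R" and n: "strict_mono n"
    and weak: "weakly_converges (\<lambda>k. x (n k)) w"
    and lim: "(\<lambda>k. norm (composed p U k (x k) - x k)) \<longlonglongrightarrow> 0"
  obtain y where y: "\<forall>k. y k \<in> cball c R" "(\<lambda>k. y k - x k) \<longlonglongrightarrow> 0"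
      "(\<lambda>k. norm (U (j k) k (y k) - y k)) \<longlonglongrightarrow> 0"
    by (rule intermediate_sequence[OF c x j lim])
  have "weakly_converges (\<lambda>k. y (n k)) w"
    unfolding weakly_converges_def
  proof (intro allI impI)
    fix f :: "'a \<Rightarrow> real" assume f: "bounded_linear f"
    have "(\<lambda>k. f (y (n k) - x (n k))) \<longlonglongrightarrow> 0"
      using bounded_linear.tendsto_zero[OF f LIMSEQ_subseq_LIMSEQ[OF y(2) n]]
      by (simp add: o_def)
    moreover have "(\<lambda>k. f (x (n k))) \<longlonglongrightarrow> f w"
      using weak f by (simp add: weakly_converges_def)
    ultimately have "(\<lambda>k. f (y (n k) - x (n k)) + f (x (n k))) \<longlonglongrightarrow> 0 + f w"
      by (rule tendsto_add)
    then show "(\<lambda>k. f (y (n k))) \<longlonglongrightarrow> f w"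
      by (simp add: linear_diff[OF bounded_linear.linear[OF f]])
  qed
  then show "w \<in> D"
    by (rule weakly_regularD[OF reg y(1) n _ y(3)])
qed

lemma regular_composed:
  assumes c: "c \<in> F" and j: "\<forall>k. j k \<in> {1..p}"
    and reg: "regular D (cball c R) (\<lambda>k. U (j k) k)"
  shows "regular D (cball c R) (composed p U)"
  unfolding regular_def
proof (intro conjI allI impI)
  show "regularity_setting D (cball c R) (composed p U)"
    by (rule regularity_setting_composed[OF regularity_settingD(2)[OF reg]])
next
  fix x
  assume x: "\<forall>k. x k \<in> cball c R"
    and lim: "(\<lambda>k. norm (composed p U k (x k) - x k)) \<longlonglongrightarrow> 0"
  obtain y where y: "\<forall>k. y k \<in> cball c R" "(\<lambda>k. y k - x k) \<longlonglongrightarrow> 0"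
      "(\<lambda>k. norm (U (j k) k (y k) - y k)) \<longlonglongrightarrow> 0"
    by (rule intermediate_sequence[OF c x j lim])
  have "(\<lambda>k. infdist (y k) D) \<longlonglongrightarrow> 0"
    by (rule regularD[OF reg y(1) y(3)])
  from tendsto_add[OF this tendsto_norm_zero[OF y(2)]]
  have bound: "(\<lambda>k. infdist (y k) D + norm (y k - x k)) \<longlonglongrightarrow> 0"
    by simp
  have le: "\<forall>k. norm (infdist (x k) D) \<le> infdist (y k) D + norm (y k - x k)"
  proof
    fix k
    show "norm (infdist (x k) D) \<le> infdist (y k) D + norm (y k - x k)"
      using infdist_triangle[of "x k" D "y k"] infdist_nonneg[of "x k" D]
      by (simp add: dist_norm norm_minus_commute)
  qed
  show "(\<lambda>k. infdist (x k) D) \<longlonglongrightarrow> 0"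
    by (rule Lim_null_comparison[OF always_eventually[OF le] bound])
qed

text \<open>
  The hypothesis \<open>1 \<le> d\<close> lets the path up to the chosen factor, which enters with weight one, be
  absorbed into a bound with weight \<open>d\<close>. That path and the step of the factor are disjoint
  pieces of the whole path, so their lengths add up to at most its length.
\<close>

lemma infdist_le_path_length:
  assumes c: "c \<in> F" and j: "j \<in> {1..p}" and d: "1 \<le> d" and x: "x \<in> cball c R"
    and reg: "\<And>y. y \<in> cball c R \<Longrightarrow> infdist y D \<le> d * norm (U j k y - y)"
  shows "infdist x D \<le> d * path_length p U k x"
proof -
  obtain l where l: "j = Suc l" "l < p"
    using j by (cases j) auto
  let ?y = "composed l U k x"
  have "?y \<in> cball c R"
    using intermediate_point(3)[OF j c x] l by simp
  have "infdist x D \<le> infdist ?y D + norm (?y - x)"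
    using infdist_triangle[of x D ?y] by (simp add: dist_norm norm_minus_commute)
  also have "\<dots> \<le> d * norm (U j k ?y - ?y) + path_length l U k x"
    using reg[OF \<open>?y \<in> cball c R\<close>] norm_composed_diff_le_path_length[of l l U k x] by simp
  also have "path_length l U k x \<le> d * path_length l U k x"
    using d mult_right_mono[of 1 d "path_length l U k x"]
    by (simp add: path_length_def sum_nonneg)
  also have "d * norm (U j k ?y - ?y) + d * path_length l U k x = d * path_length j U k x"
    by (simp add: path_length_def l algebra_simps)
  also have "\<dots> \<le> d * path_length p U k x"
    using d j by (auto simp: path_length_def intro!: mult_left_mono sum_mono2)
  finally show ?thesis
    by simp
qed

end

section \<open>Intersections\<close>

lemma regularity_setting_INT:
  assumes "I \<noteq> {}" "(\<Inter>i\<in>I. C i) \<noteq> {}" "\<And>i. i \<in> I \<Longrightarrow> regularity_setting (C i) S V"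
  shows "regularity_setting (\<Inter>i\<in>I. C i) S V"
  using assms unfolding regularity_setting_def
  by (auto intro!: closed_INT convex_INT)

lemma weakly_regular_INT:
  assumes "I \<noteq> {}" "(\<Inter>i\<in>I. C i) \<noteq> {}" "\<And>i. i \<in> I \<Longrightarrow> weakly_regular (C i) S V"
  shows "weakly_regular (\<Inter>i\<in>I. C i) S V"
  unfolding weakly_regular_def
proof (intro conjI allI impI)
  show "regularity_setting (\<Inter>i\<in>I. C i) S V"
    by (rule regularity_setting_INT[OF assms(1,2) regularity_settingD(1)[OF assms(3)]])
next
  fix x n y
  assume x: "\<forall>k. x k \<in> S" "strict_mono n" "weakly_converges (\<lambda>k. x (n k)) y"
    "(\<lambda>k. norm (V k (x k) - x k)) \<longlonglongrightarrow> 0"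
  show "y \<in> (\<Inter>i\<in>I. C i)"
    using weakly_regularD[OF assms(3) x] by (rule INT_I)
qed

lemma tendsto_Max_zero:
  fixes f :: "'b \<Rightarrow> 'c \<Rightarrow> real"
  assumes "finite I" "I \<noteq> {}" "\<And>i k. i \<in> I \<Longrightarrow> 0 \<le> f i k"
    and "\<And>i. i \<in> I \<Longrightarrow> (f i \<longlongrightarrow> 0) G"
  shows "((\<lambda>k. Max ((\<lambda>i. f i k) ` I)) \<longlongrightarrow> 0) G"
proof (rule Lim_null_comparison)
  have "norm (Max ((\<lambda>i. f i k) ` I)) \<le> (\<Sum>i\<in>I. f i k)" for k
  proof -
    have "Max ((\<lambda>i. f i k) ` I) \<in> (\<lambda>i. f i k) ` I"
      using assms by (intro Max_in) auto
    then obtain i where "i \<in> I" "Max ((\<lambda>i. f i k) ` I) = f i k"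
      by blast
    then show ?thesis
      using assms member_le_sum[of i I "\<lambda>i. f i k"] by auto
  qed
  then show "\<forall>\<^sub>F k in G. norm (Max ((\<lambda>i. f i k) ` I)) \<le> (\<Sum>i\<in>I. f i k)"
    by simp
  show "((\<lambda>k. \<Sum>i\<in>I. f i k) \<longlongrightarrow> 0) G"
    using assms tendsto_sum[of I f "\<lambda>_. 0" G] by simp
qed

lemma regular_INT:
  assumes family: "regular_family I C S"
    and reg: "\<And>i. i \<in> I \<Longrightarrow> regular (C i) S V"
  shows "regular (\<Inter>i\<in>I. C i) S V"
  unfolding regular_def
proof (intro conjI allI impI)
  have setting: "family_setting I C S"
    using family by (simp add: regular_family_def)
  show "regularity_setting (\<Inter>i\<in>I. C i) S V"
    using setting regularity_settingD(2)[OF reg]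
    by (intro regularity_setting_INT) (simp_all add: family_setting_def)
  fix x
  assume x: "\<forall>k. x k \<in> S" and lim: "(\<lambda>k. norm (V k (x k) - x k)) \<longlonglongrightarrow> 0"
  have "(\<lambda>k. Max ((\<lambda>i. infdist (x k) (C i)) ` I)) \<longlonglongrightarrow> 0"
    using setting regularD[OF reg x lim]
    by (intro tendsto_Max_zero) (simp_all add: family_setting_def infdist_nonneg)
  then show "(\<lambda>k. infdist (x k) (\<Inter>i\<in>I. C i)) \<longlonglongrightarrow> 0"
    using family x by (simp add: regular_family_def)
qed

section \<open>Linear regularity of the product\<close>

text \<open>
  The infimum of the right-hand side over \<open>c\<close> is \<open>b\<close> times the distance, and that factor cancels;
  no nearest point of \<open>A\<close> has to be chosen.
\<close>

lemma infdist_le_of_square_bound: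
  assumes "A \<noteq> {}" and "0 \<le> b"
    and bound: "\<And>c. c \<in> A \<Longrightarrow> (infdist x A)\<^sup>2 \<le> b * dist x c"
  shows "infdist x A \<le> b"
proof (cases "b = 0")
  case True
  then show ?thesis
    using bound assms(1) by fastforce
next
  case False
  then have b: "0 < b"
    using assms(2) by simp
  have "(infdist x A)\<^sup>2 / b \<le> dist x c" if "c \<in> A" for c
    using bound[OF that] b by (simp add: field_simps)
  then have "(infdist x A)\<^sup>2 / b \<le> (INF c\<in>A. dist x c)"
    by (intro cINF_greatest assms(1))
  then have "(infdist x A)\<^sup>2 / b \<le> infdist x A"
    by (simp add: infdist_notempty[OF assms(1)])
  then have "infdist x A * infdist x A \<le> b * infdist x A"
    using b by (simp add: field_simps power2_eq_square)
  then show ?thesis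
    using b infdist_nonneg[of x A] by (cases "infdist x A = 0") auto
qed

text \<open>
  At every point, each of the distances to the sets \<open>C i\<close> is at most \<open>Max (\<delta> ` I)\<close> times the
  length of the same path, although the factor that yields the bound differs from set to set. It is
  this shared path that lets linear regularity of the family be applied at that point.
\<close>

lemma (in strongly_quasi_nonexpansive_products) linearly_regular_composed:
  assumes p: "1 \<le> p" and c: "c \<in> F" and F: "F = (\<Inter>i\<in>I. C i)"
    and delta: "\<And>i. i \<in> I \<Longrightarrow> 1 \<le> \<delta> i \<and> (\<exists>j. (\<forall>k. j k \<in> {1..p}) \<and>
          linearly_regular (C i) (cball c R) (\<delta> i) (\<lambda>k. U (j k) k))"
    and family: "linearly_regular_family I C (cball c R) \<kappa>"
  shows "linearly_regular F (cball c R) (2 * real p * \<kappa>\<^sup>2 * (Max (\<delta> ` I))\<^sup>2 / r) (composed p U)"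
proof -
  let ?d = "Max (\<delta> ` I)"
  have I: "finite I" "I \<noteq> {}"
    using family by (auto simp: linearly_regular_family_def family_setting_def)
  have kappa: "\<kappa> > 0"
    and kappa_bound:
      "\<And>x. x \<in> cball c R \<Longrightarrow> infdist x F \<le> \<kappa> * Max ((\<lambda>i. infdist x (C i)) ` I)"
    using family by (auto simp: linearly_regular_family_def F)
  have d_ge: "\<delta> i \<le> ?d" if "i \<in> I" for i
    using I that by simp
  have d1: "1 \<le> ?d"
    using I delta d_ge by (meson ex_in_conv order_trans)
  have setting: "regularity_setting F (cball c R) (composed p U)"
    unfolding F
  proof (rule regularity_setting_INT)
    show "(\<Inter>i\<in>I. C i) \<noteq> {}"
      using F_nonempty F by simp
    show "regularity_setting (C i) (cball c R) (composed p U)" if "i \<in> I" for i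
      using delta[OF that] regularity_settingD(3) regularity_setting_composed by blast
  qed (fact I)
  have path: "infdist x F \<le> \<kappa> * (?d * path_length p U k x)" if x: "x \<in> cball c R" for x k
  proof -
    have "infdist x (C i) \<le> ?d * path_length p U k x" if i: "i \<in> I" for i
    proof -
      obtain j where j: "\<forall>k. j k \<in> {1..p}"
          "linearly_regular (C i) (cball c R) (\<delta> i) (\<lambda>k. U (j k) k)"
        using delta[OF i] by blast
      have "infdist x (C i) \<le> \<delta> i * path_length p U k x"
        using delta[OF i] linearly_regularD[OF j(2)]
        by (intro infdist_le_path_length[OF c spec[OF j(1)] _ x]) blast+
      also have "\<dots> \<le> ?d * path_length p U k x"
        using d_ge[OF i] by (intro mult_right_mono) (auto simp: path_length_def sum_nonneg)
      finally show ?thesis .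
    qed
    then have "Max ((\<lambda>i. infdist x (C i)) ` I) \<le> ?d * path_length p U k x"
      using I by simp
    then show ?thesis
      using kappa_bound[OF x] kappa by (meson mult_left_mono order_trans less_imp_le)
  qed
  have "infdist x F \<le> 2 * real p * \<kappa>\<^sup>2 * ?d\<^sup>2 / r * norm (composed p U k x - x)"
    if x: "x \<in> cball c R" for x k
  proof (rule infdist_le_of_square_bound[OF F_nonempty])
    show "0 \<le> 2 * real p * \<kappa>\<^sup>2 * ?d\<^sup>2 / r * norm (composed p U k x - x)"
      using r_pos by simp
    fix e assume e: "e \<in> F"
    have "(infdist x F)\<^sup>2 \<le> (\<kappa> * (?d * path_length p U k x))\<^sup>2"
      using path[OF x] by (intro power_mono infdist_nonneg)
    also have "\<dots> = (\<kappa>\<^sup>2 * ?d\<^sup>2) * (path_length p U k x)\<^sup>2"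
      by (simp add: power_mult_distrib)
    also have "\<dots> \<le> (\<kappa>\<^sup>2 * ?d\<^sup>2) * (2 * real p / r * norm (x - e) * norm (composed p U k x - x))"
      using path_length_bound[OF fixed_in[OF e]] by (intro mult_left_mono) auto
    finally show "(infdist x F)\<^sup>2
        \<le> 2 * real p * \<kappa>\<^sup>2 * ?d\<^sup>2 / r * norm (composed p U k x - x) * dist x e"
      by (simp add: dist_norm mult_ac)
  qed
  moreover have "0 < 2 * real p * \<kappa>\<^sup>2 * ?d\<^sup>2 / r"
    using p kappa d1 r_pos by simp
  ultimately show ?thesis
    using setting by (auto simp: linearly_regular_def)
qed

section \<open>Products of strongly quasi-nonexpansive operators are regular\<close>

theorem theorem5p4:
  fixes U :: "nat \<Rightarrow> nat \<Rightarrow> 'a::{real_inner, complete_space} \<Rightarrow> 'a"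
    and \<rho> :: "nat \<Rightarrow> nat \<Rightarrow> real" and rho :: real
    and C :: "nat \<Rightarrow> 'a set" and S :: "'a set"
    and p m :: nat and I J :: "nat set" and z :: 'a and R :: real
  assumes "p \<ge> 1" and "m \<ge> 1"
    and "J = {1..p}" and "I = {1..m}"
    and "\<And>j k. j \<in> J \<Longrightarrow> strongly_quasi_nonexpansive (\<rho> j k) (U j k)"
    and "rho = Min ((\<lambda>j. INF k. \<rho> j k) ` J)" and "rho > 0"
    and "\<And>i. i \<in> I \<Longrightarrow> closed (C i) \<and> convex (C i)"
    and "(\<Inter>i\<in>I. C i) \<subseteq> (\<Inter>j\<in>J. \<Inter>k. Fix (U j k))"
    and "(\<Inter>i\<in>I. C i) \<noteq> {}"
    and "z \<in> (\<Inter>i\<in>I. C i)" and "R > 0" and "S = cball z R"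
  shows
    "((\<forall>i\<in>I. (\<exists>j :: nat \<Rightarrow> nat. (\<forall>k. j k \<in> J) \<and> weakly_regular (C i) S (\<lambda>k. U (j k) k)) \<longrightarrow>
         weakly_regular (C i) S (composed p U)) \<and>
      ((\<forall>i\<in>I. \<exists>j :: nat \<Rightarrow> nat. (\<forall>k. j k \<in> J) \<and> weakly_regular (C i) S (\<lambda>k. U (j k) k)) \<longrightarrow>
         weakly_regular (\<Inter>i\<in>I. C i) S (composed p U)))
     \<and>
     ((\<forall>i\<in>I. (\<exists>j :: nat \<Rightarrow> nat. (\<forall>k. j k \<in> J) \<and> regular (C i) S (\<lambda>k. U (j k) k)) \<longrightarrow>
         regular (C i) S (composed p U)) \<and>
      ((\<forall>i\<in>I. \<exists>j :: nat \<Rightarrow> nat. (\<forall>k. j k \<in> J) \<and> regular (C i) S (\<lambda>k. U (j k) k)) \<and>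
         regular_family I C S \<longrightarrow>
         regular (\<Inter>i\<in>I. C i) S (composed p U)))
     \<and>
     (\<forall>(\<delta> :: nat \<Rightarrow> real) (\<kappa> :: real).
        (\<forall>i\<in>I. \<delta> i \<ge> 1 \<and>
           (\<exists>j :: nat \<Rightarrow> nat. (\<forall>k. j k \<in> J) \<and>
              linearly_regular (C i) S (\<delta> i) (\<lambda>k. U (j k) k))) \<and>
        linearly_regular_family I C S \<kappa> \<longrightarrow>
        linearly_regular (\<Inter>i\<in>I. C i) S (2 * real p * \<kappa>\<^sup>2 * (Max (\<delta> ` I))\<^sup>2 / rho) (composed p U))"
proof -
  have rho_le: "rho \<le> \<rho> j k" if j: "j \<in> J" for j k
  proof -
    have "rho \<le> (INF k. \<rho> j k)"
      unfolding assms(6) using j assms(3) by (intro Min_le) auto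
    also have "\<dots> \<le> \<rho> j k"
    proof (rule cINF_lower)
      have "0 \<le> \<rho> j k" for k
        using assms(5)[OF j] by (simp add: strongly_quasi_nonexpansive_def)
      \<comment> \<open>Boundedness below is what makes the real infimum a lower bound.\<close>
      then show "bdd_below (range (\<rho> j))"
        by (intro bdd_belowI2)
    qed simp
    finally show ?thesis .
  qed
  interpret strongly_quasi_nonexpansive_products p U rho "\<Inter>i\<in>I. C i"
  proof
    show "strongly_quasi_nonexpansive rho (U j k)" if "j \<in> {1..p}" for j k
      using strongly_quasi_nonexpansive_mono[OF assms(5)] that rho_le assms(3,7)
      by (simp add: less_imp_le)
  qed (use assms in auto)
  have I: "I \<noteq> {}"
    using assms(2,4) by simp
  have weak: "weakly_regular (C i) S (composed p U)"
    if "\<exists>j. (\<forall>k. j k \<in> J) \<and> weakly_regular (C i) S (\<lambda>k. U (j k) k)" for i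
  proof -
    from that obtain j where "\<forall>k. j k \<in> J" "weakly_regular (C i) S (\<lambda>k. U (j k) k)"
      by blast
    then show ?thesis
      unfolding assms(3,13) by (rule weakly_regular_composed[OF assms(11)])
  qed
  have strong: "regular (C i) S (composed p U)"
    if "\<exists>j. (\<forall>k. j k \<in> J) \<and> regular (C i) S (\<lambda>k. U (j k) k)" for i
  proof -
    from that obtain j where "\<forall>k. j k \<in> J" "regular (C i) S (\<lambda>k. U (j k) k)"
      by blast
    then show ?thesis
      unfolding assms(3,13) by (rule regular_composed[OF assms(11)])
  qed
  show ?thesis
  proof (intro conjI allI impI ballI)
    show "weakly_regular (\<Inter>i\<in>I. C i) S (composed p U)"
      if "\<forall>i\<in>I. \<exists>j. (\<forall>k. j k \<in> J) \<and> weakly_regular (C i) S (\<lambda>k. U (j k) k)"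
      by (rule weakly_regular_INT[OF I assms(10) weak[OF bspec[OF that]]])
    show "regular (\<Inter>i\<in>I. C i) S (composed p U)"
      if "(\<forall>i\<in>I. \<exists>j. (\<forall>k. j k \<in> J) \<and> regular (C i) S (\<lambda>k. U (j k) k))
        \<and> regular_family I C S"
      by (rule regular_INT[OF conjunct2[OF that] strong[OF bspec[OF conjunct1[OF that]]]])
    show "linearly_regular (\<Inter>i\<in>I. C i) S (2 * real p * \<kappa>\<^sup>2 * (Max (\<delta> ` I))\<^sup>2 / rho) (composed p U)"
      if "(\<forall>i\<in>I. \<delta> i \<ge> 1 \<and> (\<exists>j. (\<forall>k. j k \<in> J) \<and>
              linearly_regular (C i) S (\<delta> i) (\<lambda>k. U (j k) k))) \<and>
        linearly_regular_family I C S \<kappa>" for \<delta> \<kappa>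
      unfolding assms(13)
      by (rule linearly_regular_composed[OF assms(1,11) refl])
        (use that in \<open>simp_all add: assms(3,13)\<close>)
  qed (rule weak strong, assumption)+
qed

end
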